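(* Let $p,q\in(1,\infty)$ and $p^*=p/(p-1)$. If $p^*>q>1$, then $$\left(\frac{p^*}{p^*+q}\right)^{1/q}<\sin_{p,q}\frac{\pi_{p,q}}{4};$$ if $p^*=q>1$, then $$\sin_{p,p^*}\frac{\pi_{p,p^*}}{4}=\frac{1}{2^{1/p^*}};$$ and if $q>p^*>1$, then $$\sin_{p,q}\frac{\pi_{p,q}}{4}<\left(\frac{p^*}{p^*+q}\right)^{1/q}.$$
   Context: For $p,q\in(1,\infty)$ define $\sin_{p,q}^{-1}x:=\int_0^x(1-t^q)^{-1/p}\,dt$ for $0\le x\le1$ and $\pi_{p,q}:=2\sin_{p,q}^{-1}1$. The function $\sin_{p,q}:[0,\pi_{p,q}/2]\to[0,1]$ is the (increasing) inverse function of $\sin_{p,q}^{-1}$. *)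

theory Defs
  imports "HOL-Analysis.Analysis"
begin

definition conj_exp :: "real \<Rightarrow> real" where
  "conj_exp p = p / (p - 1)"

(* For p > 1 the integrand is singular at t = 1, where HOL has 0 powr a = 0; this changes it
   at one point only.  It is nonnegative, so the Henstock-Kurzweil integral used here is the
   Lebesgue (and the improper Riemann) integral. *)
definition arcsin_pq :: "real \<Rightarrow> real \<Rightarrow> real \<Rightarrow> real" where
  "arcsin_pq p q x = integral {0..x} (\<lambda>t. (1 - t powr q) powr (- 1 / p))"

definition pi_pq :: "real \<Rightarrow> real \<Rightarrow> real" where
  "pi_pq p q = 2 * arcsin_pq p q 1"

(* Meaningful on {0..pi_pq p q / 2}, the image of {0..1} under arcsin_pq p q; arbitrary elsewhere. *)
definition sin_pq :: "real \<Rightarrow> real \<Rightarrow> real \<Rightarrow> real" where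
  "sin_pq p q = the_inv_into {0..1} (arcsin_pq p q)"

end

theory Submission
  imports Defs
begin

text \<open>
  Write \<open>r\<close> for the conjugate exponent of \<open>p\<close>. The substitution \<open>u = t powr q\<close> turns \<open>q\<close> times
  \<open>arcsin_pq p q\<close> into the incomplete beta integral
  \<open>F u = \<integral>\<^sub>0\<^sup>u v powr (a - 1) * (1 - v) powr (b - 1) dv\<close> with \<open>a = 1 / q\<close> and \<open>b = 1 / r\<close>
  (\<open>arcsin_pq_beta_form\<close>). Here \<open>sin_pq p q (pi_pq p q / 4)\<close>, raised to the power \<open>q\<close>, is the
  median of the beta distribution, and \<open>r / (r + q) = a / (a + b)\<close> is its mean. So the claim
  compares mean and median of a beta distribution whose two parameters are less than 1.

  Suppose \<open>b < a \<le> 1\<close>, and let \<open>m = a / (a + b)\<close> be the mean and \<open>n = 1 - m < m\<close>. Reflect the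
  density \<open>f\<close> about the mean: the difference \<open>f (m + s) - f (m - s)\<close> is positive for
  \<open>0 < s < n\<close> (\<open>powr_reflection_less\<close>) and negative for \<open>n < s < m\<close>, where \<open>f (m + s)\<close> counts
  as 0. Its first moment in \<open>s\<close> vanishes because \<open>m\<close> is the mean; as it changes sign only once,
  from plus to minus, at \<open>s = n\<close>, its integral is \<open>1 / n\<close> times that of
  \<open>(n - s) * (f (m + s) - f (m - s))\<close>, which is positive. Hence more than half of the mass lies
  above the mean (\<open>beta_mean_less_median\<close>). Reflecting the unit interval exchanges \<open>a\<close> and \<open>b\<close>
  and reverses the inequality, and for \<open>a = b\<close> the density is symmetric about \<open>1 / 2\<close>.

  The moment argument needs no integration: the truncated first moment of \<open>f\<close> about \<open>m\<close> has the
  primitive \<open>- u powr a * (1 - u) powr b / (a + b)\<close>, which vanishes at both ends, so everything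
  follows from the monotonicity of functions with positive derivative.
\<close>

section \<open>Mean and median of the beta distribution\<close>

text \<open>
  After division this reads
  \<open>((m + s) / (m - s)) powr (1 - a) < ((n + s) / (n - s)) powr (1 - b)\<close>. Both bases exceed 1, and
  on the right both base and exponent are the larger ones.
\<close>
lemma powr_reflection_less:
  fixes a b m n s :: real
  assumes "b < a" "a \<le> 1" "0 < s" "s < n" "n < m"
  shows "(m - s) powr (a - 1) * (n + s) powr (b - 1) < (m + s) powr (a - 1) * (n - s) powr (b - 1)"
proof -
  define X where "X = (n + s) / (n - s)"
  define Y where "Y = (m + s) / (m - s)"
  have pos: "m - s > 0" "m + s > 0" "n - s > 0" "n + s > 0" using assms by auto
  have Y1: "1 < Y" unfolding Y_def using assms pos by (simp add: field_simps)
  have "(m + s) * (n - s) < (n + s) * (m - s)"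
    using mult_strict_left_mono[OF \<open>n < m\<close> \<open>0 < s\<close>] by (simp add: algebra_simps)
  then have YX: "Y < X" unfolding X_def Y_def using pos by (simp add: frac_less_eq divide_less_eq less_divide_eq mult.commute)
  have "Y powr (1 - a) \<le> X powr (1 - a)" using YX Y1 assms by (intro powr_mono2) auto
  also have "\<dots> < X powr (1 - b)" using YX Y1 assms by (intro powr_less_mono) auto
  finally have "Y powr (1 - a) < X powr (1 - b)" .
  then have *: "(m + s) powr (1 - a) * (n - s) powr (1 - b) < (n + s) powr (1 - b) * (m - s) powr (1 - a)"
    unfolding X_def Y_def using pos by (simp add: powr_divide field_simps)
  have inv: "x powr (c - 1) = inverse (x powr (1 - c))" for x c :: real
    by (metis minus_diff_eq powr_minus)
  show ?thesis unfolding inv using * pos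
    by (simp add: field_simps)
qed

text \<open>
  That \<open>a / (a + b)\<close> is the mean of the beta distribution is contained in this lemma: the primitive
  takes the value 0 at both 0 and 1.
\<close>
lemma beta_moment_primitive:
  fixes a b u :: real
  assumes "0 < a" "0 < b" "0 < u" "u < 1"
  shows "((\<lambda>u. - (u powr a * (1 - u) powr b) / (a + b)) has_real_derivative
          (u - a / (a + b)) * (u powr (a - 1) * (1 - u) powr (b - 1))) (at u)"
proof -
  have s: "u powr a = u * u powr (a - 1)" "(1 - u) powr b = (1 - u) * (1 - u) powr (b - 1)"
    using assms by (auto simp: powr_diff)
  have "((\<lambda>u. - (u powr a * (1 - u) powr b) / (a + b)) has_real_derivative
      - (a * u powr (a - 1) * (1 - u) powr b - u powr a * (b * (1 - u) powr (b - 1))) / (a + b)) (at u)"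
    using assms by (auto intro!: derivative_eq_intros simp: diff_divide_distrib mult_ac)
  moreover have "- (a * u powr (a - 1) * (1 - u) powr b - u powr a * (b * (1 - u) powr (b - 1))) / (a + b)
      = (u - a / (a + b)) * (u powr (a - 1) * (1 - u) powr (b - 1))"
    unfolding s using assms by (simp add: field_simps)
  ultimately show ?thesis by simp
qed

text \<open>
  The distribution function \<open>F\<close> is given only through its derivative and is not normalised, so that
  half of the mass lies below \<open>u\<close> if and only if \<open>2 * F u = F 0 + F 1\<close>.
\<close>
lemma beta_mean_less_median:
  fixes F :: "real \<Rightarrow> real" and a b :: real
  assumes cont: "continuous_on {0..1} F"
    and deriv: "\<And>u. 0 < u \<Longrightarrow> u < 1 \<Longrightarrow>
          (F has_real_derivative u powr (a - 1) * (1 - u) powr (b - 1)) (at u)"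
    and ab: "0 < b" "b < a" "a \<le> 1"
  shows "2 * F (a / (a + b)) < F 0 + F 1"
proof -
  define f where "f = (\<lambda>u::real. u powr (a - 1) * (1 - u) powr (b - 1))"
  define G where "G = (\<lambda>u::real. - (u powr a * (1 - u) powr b) / (a + b))"
  define m where "m = a / (a + b)"
  define n where "n = b / (a + b)"
  have mn: "0 < n" "n < m" "m + n = 1"
    using ab by (auto simp: m_def n_def divide_strict_right_mono simp flip: add_divide_distrib)
  have dF: "(F has_real_derivative f u) (at u)" if "0 < u" "u < 1" for u
    using deriv[OF that] by (simp add: f_def)
  have dG: "(G has_real_derivative (u - m) * f u) (at u)" if "0 < u" "u < 1" for u
    using beta_moment_primitive[of a b u] ab that by (simp add: f_def G_def m_def)
  have cG: "continuous_on {0..1} G"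
    unfolding G_def using ab by (intro continuous_intros continuous_on_powr') auto
  have G01: "G 0 = 0" "G 1 = 0" using ab by (auto simp: G_def)
  have reflect: "f (m - s) < f (m + s)" if "0 < s" "s < n" for s
  proof -
    have e: "1 - (m - s) = n + s" "1 - (m + s) = n - s" using mn by auto
    show ?thesis
      unfolding f_def e using that mn ab by (intro powr_reflection_less)
  qed
  \<comment> \<open>\<open>H' s = (n - s) * (f (m + s) - f (m - s))\<close>: the reflected difference, weighted by the
      distance from its sign change at \<open>s = n\<close>\<close>
  define H where "H = (\<lambda>s. n * (F (m + s) + F (m - s)) - (G (m + s) - G (m - s)))"
  have "H 0 < H n"
  proof (rule DERIV_pos_imp_increasing_open[where f = H])
    show "0 < n" by (fact mn)
    show "continuous_on {0..n} H"
      unfolding H_def using mn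
      by (intro continuous_intros continuous_on_compose2[OF cont] continuous_on_compose2[OF cG]) auto
  next
    fix s assume s: "0 < s" "s < n"
    have p: "0 < m + s" "m + s < 1" "0 < m - s" "m - s < 1" using s mn by auto
    have sh: "((\<lambda>s. m + s) has_real_derivative 1) (at s)" "((\<lambda>s. m - s) has_real_derivative - 1) (at s)"
      by (auto intro!: derivative_eq_intros)
    have "(H has_real_derivative n * (f (m + s) * 1 + f (m - s) * - 1)
        - ((m + s - m) * f (m + s) * 1 - (m - s - m) * f (m - s) * - 1)) (at s)"
      unfolding H_def
      by (intro DERIV_diff DERIV_add DERIV_cmult DERIV_chain2[OF dF] DERIV_chain2[OF dG] sh p)
    moreover have "n * (f (m + s) * 1 + f (m - s) * - 1)
        - ((m + s - m) * f (m + s) * 1 - (m - s - m) * f (m - s) * - 1) = (n - s) * (f (m + s) - f (m - s))"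
      by (simp add: algebra_simps)
    moreover have "0 < (n - s) * (f (m + s) - f (m - s))"
      using s reflect[OF s] by simp
    ultimately show "\<exists>y. (H has_real_derivative y) (at s) \<and> 0 < y"
      by (metis (no_types, lifting))
  qed
  \<comment> \<open>the range \<open>n < s < m\<close> of the reflection, where \<open>u = m - s\<close> has no mirror image inside the
      unit interval\<close>
  moreover have "- n * F 0 - G 0 < - n * F (m - n) - G (m - n)"
  proof (rule DERIV_pos_imp_increasing_open[where f = "\<lambda>u. - n * F u - G u"])
    show "0 < m - n" using mn by simp
    show "continuous_on {0..m - n} (\<lambda>u. - n * F u - G u)"
      using mn by (intro continuous_intros continuous_on_subset[OF cont] continuous_on_subset[OF cG]) auto
  next
    fix u assume u: "0 < u" "u < m - n"
    then have p: "0 < u" "u < 1" using mn by auto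
    have "((\<lambda>u. - n * F u - G u) has_real_derivative - n * f u - (u - m) * f u) (at u)"
      by (intro DERIV_diff DERIV_cmult dF dG p)
    moreover have "- n * f u - (u - m) * f u = (m - n - u) * f u" by (simp add: algebra_simps)
    moreover have "0 < (m - n - u) * f u"
      using u p by (simp add: f_def)
    ultimately show "\<exists>y. ((\<lambda>u. - n * F u - G u) has_real_derivative y) (at u) \<and> 0 < y"
      by metis
  qed
  \<comment> \<open>since \<open>m + n = 1\<close>, adding both inequalities cancels \<open>F (m - n)\<close> and \<open>G (m - n)\<close>\<close>
  ultimately have "n * (2 * F m) < n * (F 0 + F 1)"
    unfolding H_def using mn(3) G01 by (simp add: algebra_simps)
  then show ?thesis using mn by (simp add: m_def)
qed

lemma beta_median_less_mean:
  fixes F :: "real \<Rightarrow> real" and a b :: real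
  assumes cont: "continuous_on {0..1} F"
    and deriv: "\<And>u. 0 < u \<Longrightarrow> u < 1 \<Longrightarrow>
          (F has_real_derivative u powr (a - 1) * (1 - u) powr (b - 1)) (at u)"
    and ab: "0 < a" "a < b" "b \<le> 1"
  shows "F 0 + F 1 < 2 * F (a / (a + b))"
proof -
  have "2 * - F (1 - b / (b + a)) < - F (1 - 0) + - F (1 - 1)"
  proof (rule beta_mean_less_median[where F = "\<lambda>u. - F (1 - u)"])
    show "continuous_on {0..1} (\<lambda>u. - F (1 - u))"
      by (intro continuous_intros continuous_on_compose2[OF cont]) auto
  next
    fix u :: real assume u: "0 < u" "u < 1"
    have sh: "((\<lambda>u. 1 - u) has_real_derivative - 1) (at u)"
      by (auto intro!: derivative_eq_intros)
    have "((\<lambda>u. - F (1 - u)) has_real_derivative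
        - ((1 - u) powr (a - 1) * (1 - (1 - u)) powr (b - 1) * - 1)) (at u)"
      using u by (intro DERIV_minus DERIV_chain2[OF deriv] sh) auto
    then show "((\<lambda>u. - F (1 - u)) has_real_derivative u powr (b - 1) * (1 - u) powr (a - 1)) (at u)"
      by (simp add: mult.commute)
  qed (use ab in auto)
  moreover have "1 - b / (b + a) = a / (a + b)" using ab by (simp add: field_simps)
  ultimately show ?thesis by simp
qed

lemma beta_median_symmetric:
  fixes F :: "real \<Rightarrow> real" and a :: real
  assumes cont: "continuous_on {0..1} F"
    and deriv: "\<And>u. 0 < u \<Longrightarrow> u < 1 \<Longrightarrow>
          (F has_real_derivative u powr (a - 1) * (1 - u) powr (a - 1)) (at u)"
  shows "2 * F (1 / 2) = F 0 + F 1"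
proof -
  have "F (1/2) + F (1 - 1/2) = F 0 + F (1 - 0)"
  proof (rule DERIV_isconst2[where f = "\<lambda>u. F u + F (1 - u)" and b = 1])
    show "continuous_on {0..1} (\<lambda>u. F u + F (1 - u))"
      by (intro continuous_intros cont continuous_on_compose2[OF cont]) auto
  next
    fix u :: real assume u: "0 < u" "u < 1"
    have sh: "((\<lambda>u. 1 - u) has_real_derivative - 1) (at u)"
      by (auto intro!: derivative_eq_intros)
    have "((\<lambda>u. F u + F (1 - u)) has_real_derivative u powr (a - 1) * (1 - u) powr (a - 1) +
        ((1 - u) powr (a - 1) * (1 - (1 - u)) powr (a - 1) * - 1)) (at u)"
      using u by (intro DERIV_add DERIV_chain2[OF deriv] deriv sh) auto
    then show "((\<lambda>u. F u + F (1 - u)) has_real_derivative 0) (at u)"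
      by (simp add: mult.commute)
  qed auto
  then show ?thesis by simp
qed

section \<open>Reduction of the generalised arcsine to the beta integral\<close>

text \<open>
  From \<open>t powr q \<le> t\<close> on the unit interval, the integrand is at most \<open>(1 - t) powr (- 1 / p)\<close>,
  whose singularity at 1 is integrable since \<open>p > 1\<close>.
\<close>
lemma arcsin_pq_integrable:
  fixes p q :: real
  assumes "1 < p" "1 < q"
  shows "(\<lambda>t. (1 - t powr q) powr (- 1 / p)) integrable_on {0..1}"
proof (rule measurable_bounded_by_integrable_imp_integrable)
  define c where "c = 1 - 1 / p"
  have c: "0 < c" "- 1 / p = c - 1" using assms by (auto simp: c_def)
  have "((\<lambda>t. (1 - t) powr (c - 1)) has_integral - ((1 - 1) powr c) / c - - ((1 - 0) powr c) / c) {0..1}"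
  proof (rule fundamental_theorem_of_calculus_interior)
    show "continuous_on {0..1} (\<lambda>t. - ((1 - t) powr c) / c)"
      using c by (intro continuous_intros continuous_on_powr') auto
  next
    fix t :: real assume t: "t \<in> {0<..<1}"
    have "((\<lambda>t. - ((1 - t) powr c) / c) has_real_derivative (1 - t) powr (c - 1)) (at t)"
      using t c by (auto intro!: derivative_eq_intros)
    then show "((\<lambda>t. - ((1 - t) powr c) / c) has_vector_derivative (1 - t) powr (c - 1)) (at t)"
      by (simp add: has_real_derivative_iff_has_vector_derivative)
  qed simp
  then show "(\<lambda>t. (1 - t) powr (- 1 / p)) integrable_on {0..1}"
    unfolding c(2) by (rule has_integral_integrable)
  show "(\<lambda>t. (1 - t powr q) powr (- 1 / p)) \<in> borel_measurable (lebesgue_on {0..1})"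
    by (intro borel_measurable_if_D measurable_completion) measurable
  show "{0..1::real} \<in> sets lebesgue" by simp
  fix t :: real assume t: "t \<in> {0..1}"
  show "norm ((1 - t powr q) powr (- 1 / p)) \<le> (1 - t) powr (- 1 / p)"
  proof (cases "t = 1")
    case False
    have "t powr q \<le> t powr 1" using t assms by (intro powr_mono') auto
    then have "(1 - t powr q) powr (- 1 / p) \<le> (1 - t) powr (- 1 / p)"
      using t False assms by (intro powr_mono2') auto
    then show ?thesis by simp
  qed simp
qed

lemma continuous_on_arcsin_pq:
  assumes "1 < p" "1 < q"
  shows "continuous_on {0..1} (arcsin_pq p q)"
  using indefinite_integral_continuous_1[OF arcsin_pq_integrable[OF assms]]
  by (simp add: arcsin_pq_def[abs_def])

lemma DERIV_arcsin_pq: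
  assumes "1 < p" "1 < q" "0 < x" "x < 1"
  shows "(arcsin_pq p q has_real_derivative (1 - x powr q) powr (- 1 / p)) (at x)"
proof -
  define y where "y = (1 + x) / 2"
  have y: "0 < x" "x < y" "y < 1" using assms by (auto simp: y_def)
  have less: "t powr q < 1" if "t \<in> {0..y}" for t
    using powr_less_mono2[of q t 1] that assms y by simp
  have "continuous_on {0..y} (\<lambda>t. (1 - t powr q) powr (- 1 / p))"
    using assms by (intro continuous_intros continuous_on_powr') (auto dest!: less)
  then have "(arcsin_pq p q has_real_derivative (1 - x powr q) powr (- 1 / p)) (at x within {0..y})"
    unfolding arcsin_pq_def[abs_def] using y by (intro integral_has_real_derivative) auto
  moreover have "at x within {0..y} = at x"
    using y by (intro at_within_interior) auto
  ultimately show ?thesis by simp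
qed

lemma arcsin_pq_strict_mono:
  assumes "1 < p" "1 < q" "0 \<le> x" "x < y" "y \<le> 1"
  shows "arcsin_pq p q x < arcsin_pq p q y"
proof (rule DERIV_pos_imp_increasing_open[where f = "arcsin_pq p q"])
  show "x < y" by fact
  show "continuous_on {x..y} (arcsin_pq p q)"
    using assms by (intro continuous_on_subset[OF continuous_on_arcsin_pq]) auto
next
  fix t assume t: "x < t" "t < y"
  then have "0 < t" "t < 1" using assms by auto
  moreover from this have "t powr q < 1" using powr_less_mono2[of q t 1] assms by simp
  ultimately show "\<exists>d. (arcsin_pq p q has_real_derivative d) (at t) \<and> 0 < d"
    using DERIV_arcsin_pq[of p q t] assms by (intro exI[of _ "(1 - t powr q) powr (- 1 / p)"] conjI) auto
qed

lemma arcsin_pq_0 [simp]: "arcsin_pq p q 0 = 0"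
  by (simp add: arcsin_pq_def)

text \<open>
  The value \<open>pi_pq p q / 4\<close> is half of \<open>arcsin_pq p q 1\<close>, so it is attained by \<open>arcsin_pq p q\<close> on
  the unit interval; this is what makes the inverse meaningful there.
\<close>
lemma sin_pq_quarter_period:
  assumes "1 < p" "1 < q"
  shows "sin_pq p q (pi_pq p q / 4) \<in> {0..1}"
    and "arcsin_pq p q (sin_pq p q (pi_pq p q / 4)) = arcsin_pq p q 1 / 2"
proof -
  have inj: "inj_on (arcsin_pq p q) {0..1}"
    using arcsin_pq_strict_mono[OF assms]
    by (intro strict_mono_on_imp_inj_on) (auto simp: strict_mono_on_def)
  have "0 < arcsin_pq p q 1" using arcsin_pq_strict_mono[OF assms, of 0 1] by simp
  then obtain y where "0 \<le> y" "y \<le> 1" "arcsin_pq p q y = arcsin_pq p q 1 / 2"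
    using IVT'[of "arcsin_pq p q" 0 "arcsin_pq p q 1 / 2" 1] continuous_on_arcsin_pq[OF assms] by auto
  then have im: "pi_pq p q / 4 \<in> arcsin_pq p q ` {0..1}"
    by (force simp: pi_pq_def)
  show "sin_pq p q (pi_pq p q / 4) \<in> {0..1}"
    unfolding sin_pq_def by (rule the_inv_into_into[OF inj im]) simp
  show "arcsin_pq p q (sin_pq p q (pi_pq p q / 4)) = arcsin_pq p q 1 / 2"
    unfolding sin_pq_def f_the_inv_into_f[OF inj im] by (simp add: pi_pq_def)
qed

text \<open>
  The substitution \<open>u = t powr q\<close>, carried out on derivatives by the chain rule. The exponent
  matches because \<open>- 1 / p = 1 / conj_exp p - 1\<close>.
\<close>
lemma arcsin_pq_beta_form:
  fixes p q :: real
  assumes "1 < p" "1 < q"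
  defines "F \<equiv> \<lambda>u. q * arcsin_pq p q (u powr (1 / q))"
  shows "continuous_on {0..1} F"
    and "0 < u \<Longrightarrow> u < 1 \<Longrightarrow> (F has_real_derivative
           u powr (1 / q - 1) * (1 - u) powr (1 / conj_exp p - 1)) (at u)"
proof -
  have le1: "u powr (1 / q) \<le> 1" if "0 \<le> u" "u \<le> 1" for u :: real
    using powr_mono2[of "1 / q" u 1] that assms by simp
  show "continuous_on {0..1} F"
    unfolding F_def using assms
    by (intro continuous_intros continuous_on_compose2[OF continuous_on_arcsin_pq] continuous_on_powr')
       (auto intro: le1)
  assume u: "0 < u" "u < 1"
  have lt1: "u powr (1 / q) < 1"
    using powr_less_mono2[of "1 / q" u 1] u assms by simp
  have e: "- 1 / p = 1 / conj_exp p - 1" using assms by (simp add: conj_exp_def field_simps)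
  have "((\<lambda>u. u powr (1 / q)) has_real_derivative 1 / q * u powr (1 / q - 1)) (at u)"
    using u by (auto intro!: derivative_eq_intros)
  then have "(F has_real_derivative q * ((1 - (u powr (1 / q)) powr q) powr (- 1 / p) *
      (1 / q * u powr (1 / q - 1)))) (at u)"
    unfolding F_def using assms u lt1
    by (intro DERIV_cmult DERIV_chain2[OF DERIV_arcsin_pq]) auto
  then show "(F has_real_derivative u powr (1 / q - 1) * (1 - u) powr (1 / conj_exp p - 1)) (at u)"
    using assms u unfolding e by (simp add: powr_powr mult.commute)
qed

section \<open>The generalised sine at a quarter period\<close>

theorem lemma2p1:
  fixes p q :: real
  assumes "1 < p" and "1 < q"
  shows "(conj_exp p > q \<longrightarrow>
            (conj_exp p / (conj_exp p + q)) powr (1 / q) < sin_pq p q (pi_pq p q / 4)) \<and>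
         (conj_exp p = q \<longrightarrow>
            sin_pq p (conj_exp p) (pi_pq p (conj_exp p) / 4) = 1 / 2 powr (1 / conj_exp p)) \<and>
         (q > conj_exp p \<longrightarrow>
            sin_pq p q (pi_pq p q / 4) < (conj_exp p / (conj_exp p + q)) powr (1 / q))"
proof -
  define r where "r = conj_exp p"
  define x where "x = (r / (r + q)) powr (1 / q)"
  define y where "y = sin_pq p q (pi_pq p q / 4)"
  define F where "F = (\<lambda>u. q * arcsin_pq p q (u powr (1 / q)))"
  have r: "1 < r" using assms by (simp add: r_def conj_exp_def)
  have mean: "(1 / q) / (1 / q + 1 / r) = r / (r + q)"
    using r assms by (simp add: field_simps)
  have x: "0 \<le> x" "x \<le> 1"
    using powr_mono2[of "1 / q" "r / (r + q)" 1] r assms by (auto simp: x_def)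
  have y: "0 \<le> y" "y \<le> 1" and Ay: "2 * arcsin_pq p q y = arcsin_pq p q 1"
    using sin_pq_quarter_period[OF assms] by (auto simp: y_def)
  have F: "F 0 = 0" "F 1 = q * (2 * arcsin_pq p q y)" "F (r / (r + q)) = q * arcsin_pq p q x"
    using assms by (auto simp: F_def Ay x_def)
  note beta = arcsin_pq_beta_form[OF assms, folded F_def r_def]
  have "x < y" if "q < r"
  proof -
    have "2 * F (r / (r + q)) < F 0 + F 1"
      using beta_mean_less_median[OF beta] assms r that unfolding mean by (simp add: field_simps)
    then have "arcsin_pq p q x < arcsin_pq p q y" using assms by (simp add: F)
    then show ?thesis using arcsin_pq_strict_mono[OF assms, of y x] x y by (cases x y rule: linorder_cases) auto
  qed
  moreover have "y = 1 / 2 powr (1 / r)" if "r = q"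
  proof -
    have "2 * F (1 / 2) = F 0 + F 1"
      by (rule beta_median_symmetric[OF beta(1)]) (use beta(2) that in simp)
    moreover have half: "r / (r + q) = 1 / 2" using r that by simp
    ultimately have "arcsin_pq p q x = arcsin_pq p q y" using assms F by simp
    then have "x = y"
      using arcsin_pq_strict_mono[OF assms, of y x] arcsin_pq_strict_mono[OF assms, of x y] x y
      by (cases x y rule: linorder_cases) auto
    then show ?thesis using that unfolding x_def half by (simp add: powr_divide)
  qed
  moreover have "y < x" if "r < q"
  proof -
    have "F 0 + F 1 < 2 * F (r / (r + q))"
      using beta_median_less_mean[OF beta] assms r that unfolding mean by (simp add: field_simps)
    then have "arcsin_pq p q y < arcsin_pq p q x" using assms by (simp add: F)
    then show ?thesis using arcsin_pq_strict_mono[OF assms, of x y] x y by (cases x y rule: linorder_cases) auto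
  qed
  ultimately show ?thesis by (auto simp: x_def y_def r_def)
qed

end
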